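(* Let Assumptions (A1)-(A4) of the context hold and let $\{x_k\}$ be generated by Algorithm 1 (described in the context). Suppose that the singular values of $\nabla c_kA_k$ are greater than some $\delta>0$ for all $k\ge 0$. Then, with $\lambda_k=-(\nabla c_k^\top\nabla c_k)^{-1}\nabla c_k^\top\nabla f_k$ for $k\ge 0$, $$\lim_{k\to\infty}\left(\|\nabla f_k+\nabla c_k\lambda_k\|^2+\|c_k\|^2\right)=0 .$$
   Context: Problem: $\min_{x\in\mathbb{R}^d} f(x)$ subject to $c(x)=0$, with $f:\mathbb{R}^d\to\mathbb{R}$, $c=(c_1,\dots,c_m)^\top:\mathbb{R}^d\to\mathbb{R}^m$. Here $\nabla c(x)\in\mathbb{R}^{d\times m}$ has columns $\nabla c_i(x)$; $\|\cdot\|$ is the Euclidean norm (operator norm for matrices); a subscript $k$ means evaluation at $x_k$ (e.g. $c_k=c(x_k)$, $A_k=A(x_k)$). Algorithm 1. Inputs: $x_0\in\mathbb{R}^d$, $\tau\in(0,1)$, $\rho_0>0$, a mapping $A:\mathbb{R}^d\to\mathbb{R}^{m\times m}$, and the constants $\beta,L_g^f,L_g^c$ below. For $k=0,1,2,\dots$: (1) $s_k=-\mathrm{P}_{V_k}\nabla f_k-\nabla c_kA_kc_k$, where $\mathrm{P}_{V_k}$ is the orthogonal projection onto $V_k=\{v:\nabla c_k^\top v=0\}$, i.e. $\mathrm{P}_{V_k}\nabla f_k=\nabla f_k-\nabla c_k(\nabla c_k^\top\nabla c_k)^{-1}\nabla c_k^\top\nabla f_k$. If $s_k=0$, return $x_k$.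 (2) $\rho_k=\max\left\{\frac{\nabla f_k^\top s_k+\frac12\|s_k\|^2}{\beta\|c_k\|},\rho_{k-1}\right\}$ if $c_k\ne0$, and $\rho_k=\rho_{k-1}$ if $c_k=0$ (at $k=0$, $\rho_{k-1}$ means the input value $\rho_0$). (3) $\eta_k=\min\left\{\frac{\tau}{L_g^f+\rho_kL_g^c},\frac{1}{\|\nabla c_k^\top\nabla c_kA_k\|}\right\}$ and $x_{k+1}=x_k+\eta_ks_k$. Statements over all $k$ are understood with the recursion continued (so $x_{k+1}=x_k$) if $s_k=0$ occurs. Assumptions. (A1) $\mathcal X$ is an open convex set containing $\{x_k\}$; $f$ is level bounded and bounded below by $f_{\rm low}$; there is $C>0$ with $\|c(x)\|\le C$ for all $x\in\mathcal X$. (A2) $f$ and all $c_i$ are continuously differentiable, and there are positive constants $L_f,L_g^f,L_c,L_g^c$ such that for all $x,y\in\mathcal X$: $\|\nabla f(x)\|\le L_f$, $\|\nabla f(x)-\nabla f(y)\|\le L_g^f\|x-y\|$, $\|\nabla c(x)\|\le L_c$, $\|\nabla c(x)-\nabla c(y)\|\le L_g^c\|x-y\|$. (A3) (Strong LICQ) There is $\nu>0$ such that for all $x\in\mathcal X$ the singular values of $\nabla c(x)$ are bounded below by $\nu$. (A4) For all $x\in\mathcal X$ the matrix $\nabla c(x)^\top\nabla c(x)A(x)$ is symmetric, and there are $\beta,\bar\beta>0$ with $\lambda_{\min}(\nabla c(x)^\top\nabla c(x)A(x))\ge\beta$ and $\|A(x)\|\le\bar\beta$ for all $x\in\mathcal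 X$. *)

theory Defs
  imports "HOL-Analysis.Analysis"
begin

definition gradient :: "('a::real_inner \<Rightarrow> real) \<Rightarrow> 'a \<Rightarrow> 'a" where
  "gradient f x = (THE D. GDERIV f x :> D)"

(* d rows and m columns, the i-th column being the gradient of the i-th component;
   this is the transpose of the Jacobian matrix. *)
definition constr_grad :: "(real^'d \<Rightarrow> real^'m) \<Rightarrow> real^'d \<Rightarrow> real^'m^'d" where
  "constr_grad c x = (\<chi> j i. gradient (\<lambda>y. c y $ i) x $ j)"

definition continuously_differentiable :: "('a::real_inner \<Rightarrow> real) \<Rightarrow> bool" where
  "continuously_differentiable f \<longleftrightarrow>
     (\<forall>x. f differentiable (at x)) \<and> continuous_on UNIV (gradient f)"

definition level_bounded :: "('a::metric_space \<Rightarrow> real) \<Rightarrow> bool" where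
  "level_bounded f \<longleftrightarrow> (\<forall>\<alpha>. bounded {x. f x \<le> \<alpha>})"

(* Operator norm with respect to the Euclidean norms. *)
abbreviation matrix_norm :: "real^'n^'m \<Rightarrow> real" where
  "matrix_norm M \<equiv> onorm (\<lambda>v. M *v v)"

definition eigenvalues :: "real^'n^'n \<Rightarrow> real set" where
  "eigenvalues M = {\<mu>. \<exists>v. v \<noteq> 0 \<and> M *v v = \<mu> *\<^sub>R v}"

(* Meaningful for symmetric M only: the set of real eigenvalues is then finite and nonempty. *)
definition lambda_min :: "real^'n^'n \<Rightarrow> real" where
  "lambda_min M = Min (eigenvalues M)"

(* Singular values through pairs of unit left and right singular vectors. For every
   shape of M these are the min(m,n) diagonal entries of a singular value decomposition;
   in particular 0 is a singular value iff M does not have full rank. *)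
definition singular_values :: "real^'n^'m \<Rightarrow> real set" where
  "singular_values M = {\<sigma>. \<sigma> \<ge> 0 \<and>
     (\<exists>u v. norm u = 1 \<and> norm v = 1 \<and> M *v v = \<sigma> *\<^sub>R u \<and> transpose M *v u = \<sigma> *\<^sub>R v)}"

definition constr_kernel :: "(real^'d \<Rightarrow> real^'m) \<Rightarrow> real^'d \<Rightarrow> (real^'d) set" where
  "constr_kernel c x = {v. transpose (constr_grad c x) *v v = 0}"

(* Orthogonal projection onto a linear subspace. *)
abbreviation orth_proj :: "'a::euclidean_space set \<Rightarrow> 'a \<Rightarrow> 'a" where
  "orth_proj V \<equiv> closest_point V"

(* x, s, \<rho>, \<eta> are the sequences produced by the algorithm. The input value \<rho>0 plays the role
   of "\<rho> (-1)"; it need not equal \<rho> 0. If s k = 0, the iteration continues with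
   x (Suc k) = x k. *)
definition algorithm_run ::
  "(real^'d \<Rightarrow> real) \<Rightarrow> (real^'d \<Rightarrow> real^'m) \<Rightarrow> (real^'d \<Rightarrow> real^'m^'m) \<Rightarrow>
   real \<Rightarrow> real \<Rightarrow> real \<Rightarrow> real \<Rightarrow> real \<Rightarrow> real^'d \<Rightarrow>
   (nat \<Rightarrow> real^'d) \<Rightarrow> (nat \<Rightarrow> real^'d) \<Rightarrow> (nat \<Rightarrow> real) \<Rightarrow> (nat \<Rightarrow> real) \<Rightarrow> bool" where
  "algorithm_run f c A \<beta> Lgf Lgc \<tau> \<rho>0 x0 x s \<rho> \<eta> \<longleftrightarrow>
     x 0 = x0 \<and>
     (\<forall>k. s k = - orth_proj (constr_kernel c (x k)) (gradient f (x k))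
               - constr_grad c (x k) *v (A (x k) *v c (x k))) \<and>
     (\<forall>k. let \<rho>_prev = (case k of 0 \<Rightarrow> \<rho>0 | Suc j \<Rightarrow> \<rho> j) in
        \<rho> k = (if c (x k) \<noteq> 0
               then max ((gradient f (x k) \<bullet> s k + 1/2 * (norm (s k))\<^sup>2) / (\<beta> * norm (c (x k)))) \<rho>_prev
               else \<rho>_prev)) \<and>
     (\<forall>k. \<eta> k = min (\<tau> / (Lgf + \<rho> k * Lgc))
                     (1 / matrix_norm (transpose (constr_grad c (x k)) ** constr_grad c (x k) ** A (x k)))) \<and>
     (\<forall>k. x (Suc k) = x k + \<eta> k *\<^sub>R s k)"

(* The explicit formula for the projection in the step computation. *)
lemma orth_proj_constr_kernel:
  fixes c :: "real^'d \<Rightarrow> real^'m"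
  assumes N: "N = constr_grad c x" and inv: "invertible (transpose N ** N)"
  shows "orth_proj (constr_kernel c x) g =
         g - N *v (matrix_inv (transpose N ** N) *v (transpose N *v g))"
proof -
  define w where "w = matrix_inv (transpose N ** N) *v (transpose N *v g)"
  define p where "p = g - N *v w"
  have V: "constr_kernel c x = {v. transpose N *v v = 0}"
    by (simp add: constr_kernel_def N)
  have sub: "subspace (constr_kernel c x)"
    unfolding V by (rule linear_subspace_kernel[OF matrix_vector_mul_linear])
  have inv_right: "(transpose N ** N) ** matrix_inv (transpose N ** N) = mat 1"
    using inv unfolding invertible_def matrix_inv_def by (rule someI2_ex) simp
  have "transpose N *v (N *v w) = (transpose N ** N) *v w"
    by (rule matrix_vector_mul_assoc)
  also have "\<dots> = ((transpose N ** N) ** matrix_inv (transpose N ** N)) *v (transpose N *v g)"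
    unfolding w_def by (rule matrix_vector_mul_assoc)
  also have "\<dots> = transpose N *v g"
    by (simp only: inv_right matrix_vector_mul_lid)
  finally have p: "p \<in> constr_kernel c x"
    by (simp add: V p_def matrix_vector_mult_diff_distrib del: transpose_matrix_vector)
  have "dist g p \<le> dist g y" if "y \<in> constr_kernel c x" for y
  proof -
    have "p - y \<in> constr_kernel c x"
      using sub p that by (rule subspace_diff)
    then have "w \<bullet> (transpose N *v (p - y)) = 0"
      by (simp add: V del: transpose_matrix_vector)
    then have "(N *v w) \<bullet> (p - y) = 0"
      by (simp only: dot_lmul_matrix[symmetric] vector_transpose_matrix)
    then have "orthogonal (g - p) (p - y)"
      by (simp add: orthogonal_def p_def)
    then have "(norm (g - y))\<^sup>2 = (norm (g - p))\<^sup>2 + (norm (p - y))\<^sup>2"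
      using norm_add_Pythagorean[of "g - p" "p - y"] by simp
    then show ?thesis
      by (simp add: dist_norm power2_le_imp_le)
  qed
  then have "p = closest_point (constr_kernel c x) g"
    using sub p by (intro closest_point_unique) (auto simp: subspace_imp_convex closed_subspace)
  then show ?thesis
    by (simp add: p_def w_def)
qed

end

theory Submission
  imports Defs
begin

text \<open>
  Write \<open>g\<close>, \<open>N\<close>, \<open>M\<close> for \<open>\<nabla>f\<close>, \<open>\<nabla>c\<close>, \<open>\<nabla>c\<^sup>T \<nabla>c A\<close> at the current iterate. The step splits
  orthogonally as \<open>s = - p - q\<close> with the tangential part \<open>p = g + N \<lambda>\<close>, the projection of \<open>g\<close> onto the
  kernel of \<open>N\<^sup>T\<close>, and the normal part \<open>q = N A c\<close>. Therefore \<open>\<parallel>s\<parallel>\<^sup>2 = \<parallel>p\<parallel>\<^sup>2 + \<parallel>q\<parallel>\<^sup>2\<close>, and the bound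
  \<open>\<delta>\<close> on the singular values of \<open>N A\<close> gives \<open>\<parallel>q\<parallel> \<ge> \<delta> \<parallel>c\<parallel>\<close> (\<open>singular_values_lower_bound\<close>). It
  thus suffices to show that the steps \<open>s\<close> tend to \<open>0\<close>.

  This comes from the merit function \<open>f + \<rho> \<parallel>c\<parallel>\<close>. The Lipschitz bounds on the gradients control \<open>f\<close>
  (\<open>Lipschitz_gradient_upper_bound\<close>) and \<open>c\<close> (\<open>constraint_linearization_error\<close>) to second order.
  To first order \<open>c\<close> becomes \<open>(I - \<eta> M) c\<close>, since \<open>N\<^sup>T s = - M c\<close>, and this has norm at most
  \<open>(1 - \<eta> \<beta>) \<parallel>c\<parallel>\<close> (\<open>symmetric_matrix_contraction\<close>). The rule for \<open>\<rho>\<close> is made to give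
  \<open>g \<bullet> s - \<rho> \<beta> \<parallel>c\<parallel> \<le> - \<parallel>s\<parallel>\<^sup>2 / 2\<close>, and the rule for \<open>\<eta>\<close> keeps the second-order terms below a
  fraction \<open>\<tau>\<close> of the resulting gain. So the merit function drops by at least
  \<open>\<eta> (1 - \<tau>) \<parallel>s\<parallel>\<^sup>2 / 2\<close> in every iteration.

  The penalty parameter may change between iterations, but it is nondecreasing and bounded. Its
  increase is harmless for \<open>f + \<rho> (\<parallel>c\<parallel> - C)\<close>, because \<open>\<parallel>c\<parallel> \<le> C\<close>. This shifted function is bounded
  below, and as \<open>\<eta>\<close> is bounded away from \<open>0\<close>, the squares \<open>\<parallel>s\<parallel>\<^sup>2\<close> are summable.
\<close>

section \<open>Gradients and first-order Taylor bounds\<close>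

lemma GDERIV_gradient:
  fixes f :: "'a::euclidean_space \<Rightarrow> real"
  assumes "f differentiable (at x)"
  shows "GDERIV f x :> gradient f x"
proof -
  obtain f' where f': "(f has_derivative f') (at x)"
    using assms by (auto simp: differentiable_def)
  define g where "g = adjoint f' 1"
  have "f' = (\<lambda>h. h \<bullet> g)"
    unfolding g_def using adjoint_works[OF has_derivative_linear[OF f'], of _ 1] by auto
  then have ex: "GDERIV f x :> g"
    using f' by (simp add: gderiv_def)
  moreover have "D = g" if "GDERIV f x :> D" for D
    using has_derivative_unique[of f _ x, OF that[unfolded gderiv_def] ex[unfolded gderiv_def]]
    by (metis vector_eq_ldot)
  ultimately show ?thesis
    unfolding gradient_def by (rule theI)
qed

lemma GDERIV_inner_constr_grad:
  fixes c :: "real^'d \<Rightarrow> real^'m"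
  assumes "\<And>i. (\<lambda>y. c y $ i) differentiable (at x)"
  shows "GDERIV (\<lambda>y. u \<bullet> c y) x :> constr_grad c x *v u"
proof -
  have "((\<lambda>y. \<Sum>i\<in>UNIV. u $ i * c y $ i) has_derivative
      (\<lambda>h. \<Sum>i\<in>UNIV. u $ i * (h \<bullet> gradient (\<lambda>y. c y $ i) x))) (at x)"
    using GDERIV_gradient[OF assms]
    by (intro has_derivative_sum has_derivative_mult_right) (simp add: gderiv_def)
  moreover have "(\<Sum>i\<in>UNIV. u $ i * (h \<bullet> gradient (\<lambda>y. c y $ i) x)) = h \<bullet> (constr_grad c x *v u)"
    for h
    unfolding inner_vec_def matrix_vector_mult_def constr_grad_def inner_real_def
    by (simp add: sum_distrib_left, subst sum.swap) (simp add: mult_ac)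
  ultimately show ?thesis
    by (simp add: gderiv_def inner_vec_def)
qed

text \<open>Along the segment, the derivative of the difference between the two sides is nonpositive
  by Cauchy-Schwarz and the Lipschitz bound.\<close>

lemma Lipschitz_gradient_upper_bound:
  fixes F :: "'a::real_inner \<Rightarrow> real"
  assumes grad: "\<And>z. z \<in> X \<Longrightarrow> GDERIV F z :> G z"
    and lip: "\<And>y z. y \<in> X \<Longrightarrow> z \<in> X \<Longrightarrow> norm (G y - G z) \<le> L * norm (y - z)"
    and "convex X" "x \<in> X" "x + d \<in> X"
  shows "F (x + d) \<le> F x + G x \<bullet> d + L / 2 * (norm d)\<^sup>2"
proof -
  define h where "h t = F (x + t *\<^sub>R d) - t * (G x \<bullet> d) - L / 2 * t\<^sup>2 * (norm d)\<^sup>2" for t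
  have "h 1 \<le> h 0"
  proof (rule DERIV_nonpos_imp_nonincreasing[where f = h])
    fix t :: real assume t: "0 \<le> t" "t \<le> 1"
    have "(1 - t) *\<^sub>R x + t *\<^sub>R (x + d) \<in> X"
      using t assms by (intro convexD) auto
    then have tX: "x + t *\<^sub>R d \<in> X"
      by (simp add: algebra_simps)
    have "((\<lambda>t. F (x + t *\<^sub>R d)) has_derivative (\<lambda>r. (r *\<^sub>R d) \<bullet> G (x + t *\<^sub>R d))) (at t)"
      using grad[OF tX, unfolded gderiv_def]
      by (rule has_derivative_compose[rotated]) (auto intro!: derivative_eq_intros)
    then have "((\<lambda>t. F (x + t *\<^sub>R d)) has_real_derivative d \<bullet> G (x + t *\<^sub>R d)) (at t)"
      by (rule has_derivative_imp_has_field_derivative) simp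
    then have "(h has_real_derivative
        d \<bullet> G (x + t *\<^sub>R d) - G x \<bullet> d - L * t * (norm d)\<^sup>2) (at t)"
      unfolding h_def by (auto intro!: derivative_eq_intros)
    moreover have "d \<bullet> G (x + t *\<^sub>R d) - G x \<bullet> d - L * t * (norm d)\<^sup>2 \<le> 0"
    proof -
      have "d \<bullet> G (x + t *\<^sub>R d) - G x \<bullet> d = (G (x + t *\<^sub>R d) - G x) \<bullet> d"
        by (simp add: inner_diff_left inner_commute[of d])
      also have "\<dots> \<le> norm (G (x + t *\<^sub>R d) - G x) * norm d"
        by (rule norm_cauchy_schwarz)
      also have "\<dots> \<le> L * (t * norm d) * norm d"
        using lip[OF tX \<open>x \<in> X\<close>] t by (intro mult_right_mono) auto
      finally show ?thesis
        by (simp add: power2_eq_square mult_ac)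
    qed
    ultimately show "\<exists>y. (h has_real_derivative y) (at t) \<and> y \<le> 0"
      by blast
  qed simp
  then show ?thesis
    by (simp add: h_def)
qed

text \<open>The scalar bound is applied to \<open>r \<bullet> c\<close>, where \<open>r\<close> is the residual itself; testing with
  this one direction recovers the norm without any loss in the constant.\<close>

lemma constraint_linearization_error:
  fixes c :: "real^'d \<Rightarrow> real^'m"
  assumes diff: "\<And>i z. z \<in> X \<Longrightarrow> (\<lambda>y. c y $ i) differentiable (at z)"
    and lip: "\<And>y z. y \<in> X \<Longrightarrow> z \<in> X \<Longrightarrow>
         matrix_norm (constr_grad c y - constr_grad c z) \<le> L * norm (y - z)"
    and X: "convex X" "x \<in> X" "x + d \<in> X"
  shows "norm (c (x + d) - c x - transpose (constr_grad c x) *v d) \<le> L / 2 * (norm d)\<^sup>2"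
proof -
  define r where "r = c (x + d) - c x - transpose (constr_grad c x) *v d"
  have "r \<bullet> c (x + d) \<le> r \<bullet> c x + (constr_grad c x *v r) \<bullet> d + (L * norm r) / 2 * (norm d)\<^sup>2"
  proof (rule Lipschitz_gradient_upper_bound[where X = X])
    show "GDERIV (\<lambda>y. r \<bullet> c y) z :> constr_grad c z *v r" if "z \<in> X" for z
      using diff[OF that] by (rule GDERIV_inner_constr_grad)
    show "norm (constr_grad c y *v r - constr_grad c z *v r) \<le> L * norm r * norm (y - z)"
      if "y \<in> X" "z \<in> X" for y z
    proof -
      have "norm (constr_grad c y *v r - constr_grad c z *v r)
          \<le> matrix_norm (constr_grad c y - constr_grad c z) * norm r"
        unfolding matrix_vector_mult_diff_rdistrib[symmetric]
        by (rule onorm[OF matrix_vector_mul_bounded_linear])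
      also have "\<dots> \<le> L * norm (y - z) * norm r"
        by (rule mult_right_mono[OF lip[OF that]]) simp
      finally show ?thesis
        by (simp add: mult_ac)
    qed
  qed (use X in auto)
  moreover have "(constr_grad c x *v r) \<bullet> d = r \<bullet> (transpose (constr_grad c x) *v d)"
    by (metis dot_lmul_matrix vector_transpose_matrix)
  ultimately have "r \<bullet> (c (x + d) - c x - transpose (constr_grad c x) *v d)
      \<le> (L / 2 * (norm d)\<^sup>2) * norm r"
    by (simp add: inner_diff_right mult_ac del: transpose_matrix_vector)
  then have "norm r * norm r \<le> (L / 2 * (norm d)\<^sup>2) * norm r"
    unfolding r_def[symmetric] by (simp add: power2_eq_square flip: power2_norm_eq_inner)
  moreover have "0 \<le> L / 2 * (norm d)\<^sup>2"
  proof (cases "d = 0")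
    case False
    have "0 \<le> L * norm (x + d - x)"
      using lip[OF X(3,2)] onorm_pos_le[OF matrix_vector_mul_bounded_linear] by (rule order_trans[rotated])
    then show ?thesis
      using False by (simp add: zero_le_mult_iff)
  qed simp
  ultimately show ?thesis
    unfolding r_def[symmetric] by (cases "r = 0") auto
qed

section \<open>Extreme eigenvalues and singular values\<close>

text \<open>Nonnegativity of the form at \<open>B v - b v\<close> yields the operator inequality \<open>B\<^sup>2 \<le> b B\<close> from
  \<open>0 \<le> B \<le> b I\<close>. In this way bounds on the quadratic form become bounds on the norm of \<open>B v\<close>,
  without a spectral decomposition.\<close>

lemma selfadjoint_norm_square_le:
  fixes B :: "'a::real_inner \<Rightarrow> 'a"
  assumes lin: "linear B" and sym: "\<And>u w. B u \<bullet> w = u \<bullet> B w"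
    and psd: "\<And>w. 0 \<le> w \<bullet> B w" and ub: "\<And>w. w \<bullet> B w \<le> b * (w \<bullet> w)" and b: "0 < b"
  shows "B v \<bullet> B v \<le> b * (v \<bullet> B v)"
proof -
  have "0 \<le> (B v - b *\<^sub>R v) \<bullet> B (B v - b *\<^sub>R v)"
    by (rule psd)
  also have "\<dots> = B v \<bullet> B (B v) - 2 * b * (B v \<bullet> B v) + b * (b * (v \<bullet> B v))"
    using sym[of v "B v"]
    by (simp add: linear_diff[OF lin] linear_cmul[OF lin] inner_diff_left inner_diff_right
        algebra_simps)
  also have "\<dots> \<le> b * (B v \<bullet> B v) - 2 * b * (B v \<bullet> B v) + b * (b * (v \<bullet> B v))"
    using ub[of "B v"] by simp
  finally have "0 \<le> b * (b * (v \<bullet> B v) - B v \<bullet> B v)"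
    by (simp add: algebra_simps)
  then show ?thesis
    using b by (simp add: zero_le_mult_iff)
qed

lemma symmetric_matrix_inner:
  fixes M :: "real^'n^'n"
  assumes "transpose M = M"
  shows "(M *v u) \<bullet> w = u \<bullet> (M *v w)"
  by (metis assms dot_lmul_matrix vector_transpose_matrix)

text \<open>A minimizer of \<open>w \<bullet> M w\<close> on the unit sphere is an eigenvector: the shifted form
  \<open>w \<bullet> (M - \<mu> I) w\<close> is nonnegative and vanishes there, so
  \<open>selfadjoint_norm_square_le\<close> gives \<open>(M - \<mu> I) v = 0\<close>.\<close>

lemma symmetric_matrix_minimal_eigenvalue:
  fixes M :: "real^'n^'n"
  assumes sym: "transpose M = M"
  obtains v \<mu> where "norm v = 1" "M *v v = \<mu> *\<^sub>R v" "\<And>w. \<mu> * (w \<bullet> w) \<le> w \<bullet> (M *v w)"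
proof -
  have "sphere (0::real^'n) 1 \<noteq> {}"
    by simp
  moreover have "continuous_on (sphere 0 1) (\<lambda>w. w \<bullet> (M *v w))"
    by (intro continuous_intros)
  ultimately obtain v where v: "v \<in> sphere 0 1" and
      least: "\<And>w. w \<in> sphere 0 1 \<Longrightarrow> v \<bullet> (M *v v) \<le> w \<bullet> (M *v w)"
    using continuous_attains_inf[OF compact_sphere, of 0 1 "\<lambda>w. w \<bullet> (M *v w)"] by blast
  define \<mu> where "\<mu> = v \<bullet> (M *v v)"
  have form: "\<mu> * (w \<bullet> w) \<le> w \<bullet> (M *v w)" for w
  proof (cases "w = 0")
    case False
    then have "\<mu> \<le> (w /\<^sub>R norm w) \<bullet> (M *v (w /\<^sub>R norm w))"
      unfolding \<mu>_def by (intro least) simp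
    then have "\<mu> \<le> (w \<bullet> (M *v w)) / (norm w)\<^sup>2"
      by (simp add: matrix_vector_mult_scaleR power2_eq_square divide_inverse mult_ac)
    then show ?thesis
      using False by (simp add: field_simps power2_norm_eq_inner)
  qed simp
  define B where "B w = M *v w - \<mu> *\<^sub>R w" for w
  define b where "b = matrix_norm M + \<bar>\<mu>\<bar> + 1"
  have "B v \<bullet> B v \<le> b * (v \<bullet> B v)"
  proof (rule selfadjoint_norm_square_le)
    show "linear B"
      unfolding B_def by (intro linear_compose_sub matrix_vector_mul_linear linear_scale_self)
    show "B u \<bullet> w = u \<bullet> B w" for u w
      by (simp add: B_def inner_diff_left inner_diff_right symmetric_matrix_inner[OF sym])
    show "0 \<le> w \<bullet> B w" for w
      using form by (simp add: B_def inner_diff_right)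
    show "0 < b"
      using onorm_pos_le[OF matrix_vector_mul_bounded_linear, of M] by (simp add: b_def)
    show "w \<bullet> B w \<le> b * (w \<bullet> w)" for w
    proof -
      have "w \<bullet> (M *v w) \<le> norm w * norm (M *v w)"
        by (rule norm_cauchy_schwarz)
      also have "\<dots> \<le> norm w * (matrix_norm M * norm w)"
        by (intro mult_left_mono onorm matrix_vector_mul_bounded_linear) simp
      also have "\<dots> = matrix_norm M * (w \<bullet> w)"
        by (simp add: power2_eq_square flip: power2_norm_eq_inner)
      finally have "w \<bullet> B w \<le> matrix_norm M * (w \<bullet> w) - \<mu> * (w \<bullet> w)"
        by (simp add: B_def inner_diff_right)
      also have "\<dots> = (matrix_norm M - \<mu>) * (w \<bullet> w)"
        by (simp add: algebra_simps)
      also have "\<dots> \<le> b * (w \<bullet> w)"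
        by (intro mult_right_mono) (auto simp: b_def)
      finally show ?thesis .
    qed
  qed
  moreover have "v \<bullet> B v = 0"
    using v by (simp add: B_def \<mu>_def inner_diff_right flip: power2_norm_eq_inner)
  ultimately have "B v = 0"
    by (metis inner_eq_zero_iff inner_ge_zero mult_zero_right order_antisym)
  then have "M *v v = \<mu> *\<^sub>R v"
    by (simp add: B_def)
  with v form show ?thesis
    by (intro that[of v \<mu>]) auto
qed

text \<open>Eigenvectors to distinct eigenvalues are orthogonal, hence linearly independent.
  Finiteness is what makes the \<open>Min\<close> in \<open>lambda_min\<close> a lower bound of the eigenvalues.\<close>

lemma finite_eigenvalues_symmetric:
  fixes M :: "real^'n^'n"
  assumes sym: "transpose M = M"
  shows "finite (eigenvalues M)"
proof -
  define e where "e \<mu> = (SOME v. v \<noteq> 0 \<and> M *v v = \<mu> *\<^sub>R v)" for \<mu>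
  have e: "e \<mu> \<noteq> 0 \<and> M *v e \<mu> = \<mu> *\<^sub>R e \<mu>" if "\<mu> \<in> eigenvalues M" for \<mu>
  proof -
    have "\<exists>v. v \<noteq> 0 \<and> M *v v = \<mu> *\<^sub>R v"
      using that by (simp add: eigenvalues_def)
    then show ?thesis
      unfolding e_def by (rule someI_ex)
  qed
  have orth: "e \<mu> \<bullet> e \<mu>' = 0"
    if "\<mu> \<in> eigenvalues M" "\<mu>' \<in> eigenvalues M" "\<mu> \<noteq> \<mu>'" for \<mu> \<mu>'
  proof -
    have "\<mu> * (e \<mu> \<bullet> e \<mu>') = \<mu>' * (e \<mu> \<bullet> e \<mu>')"
      using symmetric_matrix_inner[OF sym, of "e \<mu>" "e \<mu>'"] e[OF that(1)] e[OF that(2)] by simp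
    then show ?thesis
      using that(3) by simp
  qed
  have "inj_on e (eigenvalues M)"
    unfolding inj_on_def using e orth by fastforce
  moreover have "finite (e ` eigenvalues M)"
  proof (intro finiteI_independent pairwise_orthogonal_independent)
    show "pairwise orthogonal (e ` eigenvalues M)"
      unfolding pairwise_def orthogonal_def using orth by fastforce
    show "0 \<notin> e ` eigenvalues M"
      using e by fastforce
  qed
  ultimately show ?thesis
    by (simp add: finite_image_iff)
qed

lemma lambda_min_le_quadratic_form:
  fixes M :: "real^'n^'n"
  assumes sym: "transpose M = M"
  shows "lambda_min M * (w \<bullet> w) \<le> w \<bullet> (M *v w)"
proof -
  obtain v \<mu> where v: "norm v = 1" "M *v v = \<mu> *\<^sub>R v"
    and form: "\<And>w. \<mu> * (w \<bullet> w) \<le> w \<bullet> (M *v w)"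
    using symmetric_matrix_minimal_eigenvalue[OF sym] by metis
  have "v \<noteq> 0"
    using v(1) by auto
  then have "lambda_min M \<le> \<mu>"
    unfolding lambda_min_def using v(2)
    by (intro Min_le finite_eigenvalues_symmetric[OF sym]) (auto simp: eigenvalues_def)
  then have "lambda_min M * (w \<bullet> w) \<le> \<mu> * (w \<bullet> w)"
    by (intro mult_right_mono) auto
  also note form
  finally show ?thesis .
qed

text \<open>The least eigenvalue of the Gram matrix is \<open>\<sigma>\<^sup>2\<close> with \<open>\<sigma>\<close> a singular value. Injectivity
  makes \<open>\<sigma>\<close> nonzero, so that the left singular vector \<open>M v / \<sigma>\<close> exists; it also excludes
  matrices with more columns than rows, for which the bound fails.\<close>

lemma singular_values_lower_bound:
  fixes M :: "real^'n^'m"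
  assumes inj: "\<And>v. M *v v = 0 \<Longrightarrow> v = 0"
    and sv: "\<And>\<sigma>. \<sigma> \<in> singular_values M \<Longrightarrow> \<delta> \<le> \<sigma>"
  shows "\<delta> * norm w \<le> norm (M *v w)"
proof -
  have gram: "u \<bullet> ((transpose M ** M) *v w) = (M *v u) \<bullet> (M *v w)" for u w
    by (metis dot_lmul_matrix matrix_vector_mul_assoc vector_transpose_matrix inner_commute)
  have "transpose (transpose M ** M) = transpose M ** M"
    by (simp add: matrix_transpose_mul)
  then obtain v \<mu> where v: "norm v = 1" "(transpose M ** M) *v v = \<mu> *\<^sub>R v"
    and form: "\<And>w. \<mu> * (w \<bullet> w) \<le> w \<bullet> ((transpose M ** M) *v w)"
    using symmetric_matrix_minimal_eigenvalue by metis
  define \<sigma> where "\<sigma> = norm (M *v v)"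
  have "v \<noteq> 0"
    using v(1) by auto
  then have \<sigma>: "0 < \<sigma>"
    using inj by (auto simp: \<sigma>_def)
  have \<mu>: "\<mu> = \<sigma>\<^sup>2"
    using gram[of v v] v
    by (simp add: \<sigma>_def power2_norm_eq_inner norm_eq_1)
  have "\<sigma> \<in> singular_values M"
  proof -
    define u where "u = (1 / \<sigma>) *\<^sub>R (M *v v)"
    have "norm u = 1" "M *v v = \<sigma> *\<^sub>R u"
      using \<sigma> by (simp_all add: u_def, simp add: \<sigma>_def)
    moreover have "transpose M *v u = \<sigma> *\<^sub>R v"
    proof -
      have "transpose M *v u = (1 / \<sigma>) *\<^sub>R ((transpose M ** M) *v v)"
        by (simp add: u_def matrix_vector_mult_scaleR matrix_vector_mul_assoc
            del: transpose_matrix_vector)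
      also have "\<dots> = \<sigma> *\<^sub>R v"
        using \<sigma> by (simp add: v(2) \<mu> power2_eq_square)
      finally show ?thesis .
    qed
    ultimately show ?thesis
      using \<sigma> v(1) unfolding singular_values_def by (auto simp del: transpose_matrix_vector)
  qed
  then have "\<delta> \<le> \<sigma>"
    by (rule sv)
  then have "\<delta> * norm w \<le> \<sigma> * norm w"
    by (intro mult_right_mono) auto
  also have "\<dots> \<le> norm (M *v w)"
  proof (rule power2_le_imp_le)
    show "(\<sigma> * norm w)\<^sup>2 \<le> (norm (M *v w))\<^sup>2"
      using form[of w] by (simp add: \<mu> gram power_mult_distrib power2_norm_eq_inner)
  qed simp
  finally show ?thesis .
qed

lemma norm_transpose_mult_le:
  fixes M :: "real^'n^'m"
  shows "norm (transpose M *v w) \<le> matrix_norm M * norm w"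
proof (cases "transpose M *v w = 0")
  case False
  have "norm (transpose M *v w) * norm (transpose M *v w)
      = (transpose M *v w) \<bullet> (transpose M *v w)"
    by (simp add: power2_eq_square flip: power2_norm_eq_inner)
  also have "\<dots> = w \<bullet> (M *v (transpose M *v w))"
    by (metis dot_lmul_matrix vector_transpose_matrix inner_commute)
  also have "\<dots> \<le> norm w * norm (M *v (transpose M *v w))"
    by (rule norm_cauchy_schwarz)
  also have "\<dots> \<le> norm w * (matrix_norm M * norm (transpose M *v w))"
    by (intro mult_left_mono onorm matrix_vector_mul_bounded_linear) simp
  finally have "norm (transpose M *v w) * norm (transpose M *v w)
      \<le> (matrix_norm M * norm w) * norm (transpose M *v w)"
    by (simp only: mult_ac)
  then show ?thesis
    using False by (simp del: transpose_matrix_vector)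
next
  case True
  then show ?thesis
    using onorm_pos_le[OF matrix_vector_mul_bounded_linear, of M]
    by (simp del: transpose_matrix_vector)
qed

text \<open>Here \<open>I - t M\<close> is positive semidefinite because \<open>t \<le> 1 / \<parallel>M\<parallel>\<close>, and its quadratic form
  is at most \<open>1 - t \<beta>\<close>. For a self-adjoint operator such bounds on the form bound the norm.\<close>

lemma symmetric_matrix_contraction:
  fixes M :: "real^'n^'n"
  assumes sym: "transpose M = M" and lb: "\<And>w. \<beta> * (w \<bullet> w) \<le> w \<bullet> (M *v w)" and \<beta>: "0 < \<beta>"
    and t: "0 \<le> t" "t * matrix_norm M \<le> 1"
  shows "norm (v - t *\<^sub>R (M *v v)) \<le> (1 - t * \<beta>) * norm v"
proof (cases "v = 0")
  case v: False
  define B where "B w = w - t *\<^sub>R (M *v w)" for w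
  define b where "b = 1 - t * \<beta>"
  have psd: "0 \<le> w \<bullet> B w" for w
  proof -
    have "t * (w \<bullet> (M *v w)) \<le> t * (norm w * norm (M *v w))"
      by (rule mult_left_mono[OF norm_cauchy_schwarz t(1)])
    also have "\<dots> \<le> t * (norm w * (matrix_norm M * norm w))"
      by (intro mult_left_mono onorm matrix_vector_mul_bounded_linear t(1)) simp
    also have "\<dots> = (t * matrix_norm M) * (w \<bullet> w)"
      by (simp add: power2_eq_square flip: power2_norm_eq_inner)
    also have "\<dots> \<le> 1 * (w \<bullet> w)"
      by (rule mult_right_mono[OF t(2)]) simp
    finally show ?thesis
      by (simp add: B_def inner_diff_right)
  qed
  have ub: "w \<bullet> B w \<le> b * (w \<bullet> w)" for w
    using mult_left_mono[OF lb[of w] t(1)] by (simp add: B_def b_def inner_diff_right algebra_simps)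
  have "0 \<le> b"
    using order_trans[OF psd ub, of v] v by (simp add: zero_le_mult_iff flip: power2_norm_eq_inner)
  have bound: "B v \<bullet> B v \<le> a * (v \<bullet> B v)" if "b \<le> a" "0 < a" for a
  proof (rule selfadjoint_norm_square_le)
    show "linear B"
      unfolding B_def
      by (intro linear_compose_sub linear_id[unfolded id_def] linear_compose_scale_right
          matrix_vector_mul_linear)
    show "B u \<bullet> w = u \<bullet> B w" for u w
      by (simp add: B_def inner_diff_left inner_diff_right symmetric_matrix_inner[OF sym])
    show "w \<bullet> B w \<le> a * (w \<bullet> w)" for w
      using ub[of w] that(1) by (meson inner_ge_zero mult_right_mono order_trans)
  qed (use psd that in auto)
  have "B v \<bullet> B v \<le> b * (b * (v \<bullet> v))"
    \<comment> \<open>If \<open>b = 0\<close>, the form vanishes at \<open>v\<close>, and the bound with \<open>a = 1\<close> already gives \<open>B v = 0\<close>.\<close>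
  proof (cases "b = 0")
    case True
    then show ?thesis
      using bound[of 1] ub[of v] by simp
  next
    case False
    then have "B v \<bullet> B v \<le> b * (v \<bullet> B v)"
      using \<open>0 \<le> b\<close> by (intro bound) auto
    also have "\<dots> \<le> b * (b * (v \<bullet> v))"
      by (rule mult_left_mono[OF ub \<open>0 \<le> b\<close>])
    finally show ?thesis .
  qed
  then have "(norm (B v))\<^sup>2 \<le> (b * norm v)\<^sup>2"
    by (simp add: power_mult_distrib power2_norm_eq_inner) (simp add: power2_eq_square)
  then show ?thesis
    unfolding B_def b_def
    by (rule power2_le_imp_le) (use \<open>0 \<le> b\<close> in \<open>simp add: b_def\<close>)
qed simp

section \<open>Convergence\<close>

lemma sufficient_decrease_tendsto_zero:
  fixes \<Psi> u :: "nat \<Rightarrow> real"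
  assumes dec: "\<And>k. \<Psi> (Suc k) \<le> \<Psi> k - a * u k" and a: "0 < a"
    and nonneg: "\<And>k. 0 \<le> u k" and bounded: "\<And>k. l \<le> \<Psi> k"
  shows "u \<longlonglongrightarrow> 0"
proof -
  have "(\<Sum>k<n. a * u k) \<le> \<Psi> 0 - \<Psi> n" for n
  proof (induction n)
    case (Suc n)
    then show ?case
      using dec[of n] by simp
  qed simp
  then have "(\<Sum>k<n. a * u k) \<le> \<Psi> 0 - l" for n
    using bounded[of n] by (smt (verit))
  then have "summable (\<lambda>k. a * u k)"
    using a nonneg by (intro summableI_nonneg_bounded) auto
  then have "(\<lambda>k. inverse a * (a * u k)) \<longlonglongrightarrow> inverse a * 0"
    by (intro tendsto_mult_left summable_LIMSEQ_zero)
  then show ?thesis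
    using a by (simp add: field_simps)
qed

text \<open>Surjectivity passes from the product to its left factor, and for square matrices this is
  invertibility.\<close>

lemma invertible_gram_of_injective_product:
  fixes N :: "real^'m^'d" and A :: "real^'m^'m"
  assumes "\<And>w. (transpose N ** N ** A) *v w = 0 \<Longrightarrow> w = 0"
  shows "invertible (transpose N ** N)"
proof -
  have "inj ((*v) (transpose N ** N ** A))"
    using assms by (auto simp: linear_injective_0[OF matrix_vector_mul_linear])
  then have "invertible (transpose N ** N ** A)"
    by (simp add: invertible_left_inverse matrix_left_invertible_injective)
  then obtain B where "transpose N ** N ** A ** B = mat 1"
    by (auto simp: invertible_def)
  then have "(transpose N ** N) ** (A ** B) = mat 1"
    by (simp add: matrix_mul_assoc)
  then show ?thesis
    by (auto simp: invertible_right_inverse)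
qed

theorem theorem1:
  fixes f :: "real^'d \<Rightarrow> real"
    and c :: "real^'d \<Rightarrow> real^'m"
    and A :: "real^'d \<Rightarrow> real^'m^'m"
    and X :: "(real^'d) set"
    and x s :: "nat \<Rightarrow> real^'d" and \<rho> \<eta> :: "nat \<Rightarrow> real"
    and x0 :: "real^'d"
    and lam :: "nat \<Rightarrow> real^'m"
    and \<tau> \<rho>0 \<beta> \<beta>bar Lf Lgf Lc Lgc C flow \<nu> \<delta> :: real
  assumes inputs: "0 < \<tau>" "\<tau> < 1" "0 < \<rho>0"
    and run: "algorithm_run f c A \<beta> Lgf Lgc \<tau> \<rho>0 x0 x s \<rho> \<eta>"
    and A1: "open X" "convex X" "\<And>k. x k \<in> X"
      "level_bounded f" "\<And>y. flow \<le> f y"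
      "0 < C" "\<And>y. y \<in> X \<Longrightarrow> norm (c y) \<le> C"
    and A2: "continuously_differentiable f"
      "\<And>i. continuously_differentiable (\<lambda>y. c y $ i)"
      "0 < Lf" "0 < Lgf" "0 < Lc" "0 < Lgc"
      "\<And>y. y \<in> X \<Longrightarrow> norm (gradient f y) \<le> Lf"
      "\<And>y z. y \<in> X \<Longrightarrow> z \<in> X \<Longrightarrow> norm (gradient f y - gradient f z) \<le> Lgf * norm (y - z)"
      "\<And>y. y \<in> X \<Longrightarrow> matrix_norm (constr_grad c y) \<le> Lc"
      "\<And>y z. y \<in> X \<Longrightarrow> z \<in> X \<Longrightarrow>
         matrix_norm (constr_grad c y - constr_grad c z) \<le> Lgc * norm (y - z)"
    and A3: "0 < \<nu>"
      "\<And>y \<sigma>. y \<in> X \<Longrightarrow> \<sigma> \<in> singular_values (constr_grad c y) \<Longrightarrow> \<nu> \<le> \<sigma>"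
    and A4: "0 < \<beta>" "0 < \<beta>bar"
      "\<And>y. y \<in> X \<Longrightarrow>
         transpose (transpose (constr_grad c y) ** constr_grad c y ** A y)
           = transpose (constr_grad c y) ** constr_grad c y ** A y"
      "\<And>y. y \<in> X \<Longrightarrow> \<beta> \<le> lambda_min (transpose (constr_grad c y) ** constr_grad c y ** A y)"
      "\<And>y. y \<in> X \<Longrightarrow> matrix_norm (A y) \<le> \<beta>bar"
    and delta: "0 < \<delta>"
      "\<And>k \<sigma>. \<sigma> \<in> singular_values (constr_grad c (x k) ** A (x k)) \<Longrightarrow> \<delta> < \<sigma>"
    and multipliers: "\<And>k. lam k =
      - (matrix_inv (transpose (constr_grad c (x k)) ** constr_grad c (x k))
           *v (transpose (constr_grad c (x k)) *v gradient f (x k)))"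
  shows "(\<lambda>k. (norm (gradient f (x k) + constr_grad c (x k) *v lam k))\<^sup>2 + (norm (c (x k)))\<^sup>2)
           \<longlonglongrightarrow> 0"
proof -
  define g where "g k = gradient f (x k)" for k
  define N where "N k = constr_grad c (x k)" for k
  define M where "M k = transpose (N k) ** N k ** A (x k)" for k
  define cc where "cc k = c (x k)" for k
  define q where "q k = N k *v (A (x k) *v cc k)" for k
  define p where "p k = g k + N k *v lam k" for k
  have inner_transpose: "(transpose B *v u) \<bullet> w = u \<bullet> (B *v w)" for B :: "real^'m^'d" and u w
    by (simp add: dot_lmul_matrix)

  have M_sym: "transpose (M k) = M k" for k
    unfolding M_def N_def by (rule A4(3)[OF A1(3)])
  have M_lower: "\<beta> * (w \<bullet> w) \<le> w \<bullet> (M k *v w)" for k w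
  proof -
    have "\<beta> * (w \<bullet> w) \<le> lambda_min (M k) * (w \<bullet> w)"
      unfolding M_def N_def by (rule mult_right_mono[OF A4(4)[OF A1(3)]]) simp
    also have "\<dots> \<le> w \<bullet> (M k *v w)"
      by (rule lambda_min_le_quadratic_form[OF M_sym])
    finally show ?thesis .
  qed
  have M_inj: "w = 0" if "M k *v w = 0" for k w
    using M_lower[of w k] that A4(1) by (simp add: mult_le_0_iff flip: power2_norm_eq_inner)
  have M_norm_pos: "0 < matrix_norm (M k)" for k
  proof -
    have "M k *v 1 \<noteq> 0"
      using M_inj[of k 1] one_neq_zero by blast
    then show ?thesis
      by (subst onorm_pos_lt[OF matrix_vector_mul_bounded_linear]) blast
  qed
  have gram_inv: "invertible (transpose (N k) ** N k)" for k
    using M_inj[of k] unfolding M_def by (rule invertible_gram_of_injective_product)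

  have proj: "orth_proj (constr_kernel c (x k)) (g k) = p k" for k
    using orth_proj_constr_kernel[OF N_def gram_inv, of k "g k"] multipliers[of k]
    by (simp add: p_def g_def N_def linear_neg[OF matrix_vector_mul_linear] del: transpose_matrix_vector)
  \<comment> \<open>The tangential part \<open>p k\<close> lies in the kernel of \<open>transpose (N k)\<close> and the normal part \<open>q k\<close>
    in its orthogonal complement, the range of \<open>N k\<close>.\<close>
  have NTp: "transpose (N k) *v p k = 0" for k
  proof -
    have "subspace (constr_kernel c (x k))"
      unfolding constr_kernel_def by (rule linear_subspace_kernel[OF matrix_vector_mul_linear])
    then have "p k \<in> constr_kernel c (x k)"
      unfolding proj[symmetric]
      by (intro closest_point_in_set closed_subspace) (auto dest: subspace_0)
    then show ?thesis
      by (simp add: constr_kernel_def N_def)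
  qed
  have p_orth: "p k \<bullet> (N k *v u) = 0" for k u
    using inner_transpose[of "N k" "p k" u] NTp by (simp del: transpose_matrix_vector)
  have s_eq: "s k = - p k - q k" for k
    using run proj[of k] unfolding algorithm_run_def by (simp add: g_def q_def N_def cc_def)
  have s_norm: "(norm (s k))\<^sup>2 = (norm (p k))\<^sup>2 + (norm (q k))\<^sup>2" for k
    using p_orth[of k "A (x k) *v cc k"]
    by (simp add: s_eq power2_norm_eq_inner q_def inner_diff_left inner_diff_right inner_commute)
  have gs: "g k \<bullet> s k = - (norm (p k))\<^sup>2 - g k \<bullet> q k" for k
  proof -
    have "g k \<bullet> p k = (p k - N k *v lam k) \<bullet> p k"
      by (simp add: p_def)
    also have "\<dots> = (norm (p k))\<^sup>2"
      using p_orth[of k "lam k"] by (simp add: inner_diff_left inner_commute[of "N k *v lam k"] power2_norm_eq_inner)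
    finally show ?thesis
      by (simp add: s_eq inner_diff_right)
  qed
  have NTs: "transpose (N k) *v s k = - (M k *v cc k)" for k
    using NTp[of k]
    by (simp add: s_eq q_def M_def matrix_vector_mult_diff_distrib linear_neg[OF matrix_vector_mul_linear]
        matrix_vector_mul_assoc matrix_mul_assoc del: transpose_matrix_vector)

  define K where "K = Lc * \<beta>bar"
  have K: "0 < K"
    using A2 A4 by (simp add: K_def)
  have q_upper: "norm (q k) \<le> K * norm (cc k)" for k
  proof -
    have "norm (q k) \<le> matrix_norm (N k) * norm (A (x k) *v cc k)"
      unfolding q_def by (rule onorm[OF matrix_vector_mul_bounded_linear])
    also have "\<dots> \<le> Lc * norm (A (x k) *v cc k)"
      unfolding N_def by (rule mult_right_mono[OF A2(9)[OF A1(3)]]) simp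
    also have "\<dots> \<le> Lc * (matrix_norm (A (x k)) * norm (cc k))"
      using A2(5) by (intro mult_left_mono onorm[OF matrix_vector_mul_bounded_linear]) simp
    also have "\<dots> \<le> Lc * (\<beta>bar * norm (cc k))"
      using A2(5) A4(5)[OF A1(3)] by (intro mult_left_mono mult_right_mono) auto
    finally show ?thesis
      by (simp add: K_def mult_ac)
  qed
  have q_lower: "\<delta> * norm (cc k) \<le> norm (q k)" for k
  proof -
    have "\<delta> * norm (cc k) \<le> norm ((N k ** A (x k)) *v cc k)"
    proof (rule singular_values_lower_bound)
      show "w = 0" if "(N k ** A (x k)) *v w = 0" for w
      proof (rule M_inj)
        have "M k *v w = transpose (N k) *v ((N k ** A (x k)) *v w)"
          by (simp add: M_def matrix_vector_mul_assoc matrix_mul_assoc del: transpose_matrix_vector)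
        then show "M k *v w = 0"
          by (simp add: that del: transpose_matrix_vector)
      qed
      show "\<delta> \<le> \<sigma>" if "\<sigma> \<in> singular_values (N k ** A (x k))" for \<sigma>
        using delta(2) that unfolding N_def by fastforce
    qed
    then show ?thesis
      by (simp add: q_def matrix_vector_mul_assoc)
  qed
  have M_norm_le: "matrix_norm (M k) \<le> Lc * K" for k
  proof (rule onorm_le)
    fix w
    have "norm (M k *v w) = norm (transpose (N k) *v (N k *v (A (x k) *v w)))"
      by (simp add: M_def matrix_vector_mul_assoc matrix_mul_assoc del: transpose_matrix_vector)
    also have "\<dots> \<le> matrix_norm (N k) * norm (N k *v (A (x k) *v w))"
      by (rule norm_transpose_mult_le)
    also have "\<dots> \<le> matrix_norm (N k) * (matrix_norm (N k) * (matrix_norm (A (x k)) * norm w))"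
      by (intro mult_left_mono order_trans[OF onorm[OF matrix_vector_mul_bounded_linear]]
          onorm onorm_pos_le matrix_vector_mul_bounded_linear)
    also have "\<dots> \<le> Lc * (Lc * (\<beta>bar * norm w))"
      using A2(5) A4(2) A2(9)[OF A1(3)] A4(5)[OF A1(3)] unfolding N_def
      by (intro mult_mono mult_nonneg_nonneg onorm_pos_le matrix_vector_mul_bounded_linear) auto
    finally show "norm (M k *v w) \<le> Lc * K * norm w"
      by (simp add: K_def mult_ac)
  qed

  have cc_le: "norm (cc k) \<le> C" for k
    unfolding cc_def by (rule A1(7)[OF A1(3)])
  \<comment> \<open>The numerator in the penalty rule is \<open>- \<parallel>p\<parallel>\<^sup>2 / 2 - g \<bullet> q + \<parallel>q\<parallel>\<^sup>2 / 2\<close>. Only the terms with \<open>q\<close> can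
    be positive, and these are \<open>O(\<parallel>c\<parallel>)\<close>; hence the quotients, and with them \<open>\<rho> k\<close>, stay bounded.\<close>
  define num where "num k = g k \<bullet> s k + 1/2 * (norm (s k))\<^sup>2" for k
  define R where "R = Lf * K + 1/2 * K * (K * C)"
  have num_le: "num k \<le> R * norm (cc k)" for k
  proof -
    have "num k = - (1/2 * (norm (p k))\<^sup>2) + - g k \<bullet> q k + 1/2 * (norm (q k))\<^sup>2"
      by (simp add: num_def gs s_norm field_simps)
    also have "\<dots> \<le> 0 + norm (g k) * norm (q k) + 1/2 * (norm (q k) * norm (q k))"
      using norm_cauchy_schwarz[of "- g k" "q k"]
      by (intro add_mono) (auto simp: power2_eq_square)
    also have "\<dots> \<le> 0 + Lf * (K * norm (cc k)) + 1/2 * ((K * norm (cc k)) * (K * C))"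
    proof (intro add_mono mult_left_mono mult_mono)
      show "norm (g k) \<le> Lf"
        unfolding g_def by (rule A2(7)[OF A1(3)])
      show "norm (q k) \<le> K * C"
        using order_trans[OF q_upper mult_left_mono[OF cc_le less_imp_le[OF K]]] .
    qed (use q_upper A2(3) K in auto)
    also have "\<dots> = R * norm (cc k)"
      by (simp add: R_def algebra_simps)
    finally show ?thesis .
  qed

  have rho_rec: "\<rho> k = (if cc k \<noteq> 0 then max (num k / (\<beta> * norm (cc k))) r else r)"
    if "r = (case k of 0 \<Rightarrow> \<rho>0 | Suc j \<Rightarrow> \<rho> j)" for k r
    using run that unfolding algorithm_run_def Let_def num_def cc_def g_def by blast
  have rho_prev_le: "(case k of 0 \<Rightarrow> \<rho>0 | Suc j \<Rightarrow> \<rho> j) \<le> \<rho> k" for k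
    using rho_rec[OF refl, of k] by (simp split: if_splits)
  have rho_mono: "\<rho> k \<le> \<rho> (Suc k)" for k
    using rho_prev_le[of "Suc k"] by simp
  have rho_pos: "0 < \<rho> k" for k
  proof (induction k)
    case 0
    show ?case using rho_prev_le[of 0] inputs(3) by simp
  next
    case (Suc k)
    then show ?case using rho_mono[of k] by simp
  qed
  define \<rho>max where "\<rho>max = max \<rho>0 (R / \<beta>)"
  have quot_le: "num k / (\<beta> * norm (cc k)) \<le> \<rho>max" if "cc k \<noteq> 0" for k
  proof -
    have "num k / (\<beta> * norm (cc k)) \<le> R / \<beta>"
      using num_le[of k] that A4(1) by (simp add: field_simps)
    then show ?thesis
      by (simp add: \<rho>max_def)
  qed
  have rho_le: "\<rho> k \<le> \<rho>max" for k
  proof (induction k)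
    case 0
    show ?case
      using rho_rec[OF refl, of 0] quot_le[of 0] by (auto simp: \<rho>max_def)
  next
    case (Suc k)
    then show ?case
      using rho_rec[OF refl, of "Suc k"] quot_le[of "Suc k"] by auto
  qed
  \<comment> \<open>For \<open>c = 0\<close>, where the penalty rule keeps the old value, the bound \<open>num_le\<close> gives the claim.\<close>
  have num_le_rho: "num k \<le> \<rho> k * \<beta> * norm (cc k)" for k
  proof (cases "cc k = 0")
    case True
    then show ?thesis
      using num_le[of k] by simp
  next
    case False
    then have "num k / (\<beta> * norm (cc k)) \<le> \<rho> k"
      using rho_rec[OF refl, of k] by simp
    then show ?thesis
      using False A4(1) by (simp add: field_simps)
  qed

  have eta_eq: "\<eta> k = min (\<tau> / (Lgf + \<rho> k * Lgc)) (1 / matrix_norm (M k))" for k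
    using run unfolding algorithm_run_def M_def N_def by blast
  have Lsum_pos: "0 < Lgf + \<rho> k * Lgc" for k
    using A2(4,6) rho_pos[of k] by (simp add: add_pos_pos)
  have eta_curv: "\<eta> k * (Lgf + \<rho> k * Lgc) \<le> \<tau>" for k
    using Lsum_pos[of k] eta_eq[of k] by (simp add: pos_le_divide_eq[symmetric])
  have eta_M: "\<eta> k * matrix_norm (M k) \<le> 1" for k
    using M_norm_pos[of k] eta_eq[of k] by (simp add: pos_le_divide_eq[symmetric])
  \<comment> \<open>The step sizes stay away from \<open>0\<close> because \<open>\<rho> k\<close> and \<open>\<parallel>M k\<parallel>\<close> are bounded.\<close>
  define \<eta>min where "\<eta>min = min (\<tau> / (Lgf + \<rho>max * Lgc)) (1 / (Lc * K))"
  have "0 < \<rho>max"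
    using inputs(3) by (simp add: \<rho>max_def)
  then have eta_min_pos: "0 < \<eta>min"
    using inputs(1) A2(4,5,6) K by (simp add: \<eta>min_def add_pos_pos)
  have eta_ge: "\<eta>min \<le> \<eta> k" for k
    unfolding eta_eq \<eta>min_def
  proof (rule min.mono)
    show "\<tau> / (Lgf + \<rho>max * Lgc) \<le> \<tau> / (Lgf + \<rho> k * Lgc)"
      using inputs(1) A2(6) Lsum_pos[of k] rho_le[of k]
      by (intro divide_left_mono mult_pos_pos) (auto intro: add_mono order.strict_trans2)
    show "1 / (Lc * K) \<le> 1 / matrix_norm (M k)"
      by (rule divide_left_mono[OF M_norm_le]) (use M_norm_pos A2(5) K in auto)
  qed
  have eta_pos: "0 < \<eta> k" for k
    using eta_min_pos eta_ge[of k] by simp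

  have x_Suc: "x (Suc k) = x k + \<eta> k *\<^sub>R s k" for k
    using run unfolding algorithm_run_def by blast
  have f_step: "f (x (Suc k)) \<le> f (x k) + \<eta> k * (g k \<bullet> s k) + Lgf / 2 * (\<eta> k)\<^sup>2 * (norm (s k))\<^sup>2"
    for k
  proof -
    have "f (x k + \<eta> k *\<^sub>R s k)
        \<le> f (x k) + gradient f (x k) \<bullet> (\<eta> k *\<^sub>R s k) + Lgf / 2 * (norm (\<eta> k *\<^sub>R s k))\<^sup>2"
    proof (rule Lipschitz_gradient_upper_bound[where X = X])
      show "GDERIV f z :> gradient f z" for z
        using A2(1) by (intro GDERIV_gradient) (simp add: continuously_differentiable_def)
    qed (use A1 A2 in \<open>auto simp flip: x_Suc\<close>)
    then show ?thesis
      by (simp add: x_Suc g_def power_mult_distrib)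
  qed
  have c_step: "norm (cc (Suc k))
      \<le> (1 - \<eta> k * \<beta>) * norm (cc k) + Lgc / 2 * (\<eta> k)\<^sup>2 * (norm (s k))\<^sup>2" for k
  proof -
    define r where "r = c (x k + \<eta> k *\<^sub>R s k) - c (x k)
      - transpose (constr_grad c (x k)) *v (\<eta> k *\<^sub>R s k)"
    have "norm r \<le> Lgc / 2 * (norm (\<eta> k *\<^sub>R s k))\<^sup>2"
      unfolding r_def
    proof (rule constraint_linearization_error[where X = X])
      show "(\<lambda>y. c y $ i) differentiable at z" for i z
        using A2(2)[of i] by (simp add: continuously_differentiable_def)
    qed (use A1 A2(10) in \<open>auto simp flip: x_Suc\<close>)
    moreover have "cc (Suc k) = (cc k - \<eta> k *\<^sub>R (M k *v cc k)) + r"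
      using NTs[of k]
      by (simp add: r_def cc_def x_Suc N_def matrix_vector_mult_scaleR del: transpose_matrix_vector)
    moreover have "norm (cc k - \<eta> k *\<^sub>R (M k *v cc k)) \<le> (1 - \<eta> k * \<beta>) * norm (cc k)"
      by (rule symmetric_matrix_contraction[OF M_sym M_lower A4(1) less_imp_le[OF eta_pos] eta_M])
    ultimately show ?thesis
      using norm_triangle_ineq[of "cc k - \<eta> k *\<^sub>R (M k *v cc k)" r]
      by (simp add: power_mult_distrib)
  qed

  \<comment> \<open>The penalty rule makes the first-order change of the merit function at most
    \<open>- \<eta> \<parallel>s\<parallel>\<^sup>2 / 2\<close>; the second-order terms take back at most the fraction \<open>\<tau>\<close> of it.\<close>
  have merit_step: "f (x (Suc k)) + \<rho> k * norm (cc (Suc k))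
      \<le> f (x k) + \<rho> k * norm (cc k) - \<eta>min * (1 - \<tau>) / 2 * (norm (s k))\<^sup>2" for k
  proof -
    have "f (x (Suc k)) + \<rho> k * norm (cc (Suc k))
        \<le> (f (x k) + \<eta> k * (g k \<bullet> s k) + Lgf / 2 * (\<eta> k)\<^sup>2 * (norm (s k))\<^sup>2)
          + \<rho> k * ((1 - \<eta> k * \<beta>) * norm (cc k) + Lgc / 2 * (\<eta> k)\<^sup>2 * (norm (s k))\<^sup>2)"
      by (intro add_mono f_step mult_left_mono c_step less_imp_le[OF rho_pos])
    also have "\<dots> = f (x k) + \<rho> k * norm (cc k) + \<eta> k * (g k \<bullet> s k - \<rho> k * \<beta> * norm (cc k))
          + (\<eta> k * (Lgf + \<rho> k * Lgc)) * (\<eta> k / 2 * (norm (s k))\<^sup>2)"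
      by (simp add: field_simps power2_eq_square)
    also have "\<dots> \<le> f (x k) + \<rho> k * norm (cc k) + \<eta> k * (- (1/2) * (norm (s k))\<^sup>2)
          + \<tau> * (\<eta> k / 2 * (norm (s k))\<^sup>2)"
      using num_le_rho[of k] eta_curv[of k] eta_pos[of k]
      by (intro add_mono mult_left_mono mult_right_mono) (auto simp: num_def)
    also have "\<dots> = f (x k) + \<rho> k * norm (cc k) - \<eta> k * ((1 - \<tau>) / 2 * (norm (s k))\<^sup>2)"
      by (simp add: field_simps)
    also have "\<dots> \<le> f (x k) + \<rho> k * norm (cc k) - \<eta>min * ((1 - \<tau>) / 2 * (norm (s k))\<^sup>2)"
      using inputs(2) by (intro diff_left_mono mult_right_mono eta_ge) auto
    finally show ?thesis
      by simp
  qed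

  \<comment> \<open>Since \<open>\<parallel>c\<parallel> - C\<close> is nonpositive, increasing \<open>\<rho>\<close> can only decrease the shifted merit function
    \<open>f + \<rho> (\<parallel>c\<parallel> - C)\<close>, so it decreases along the whole run.\<close>
  have "(\<lambda>k. (norm (s k))\<^sup>2) \<longlonglongrightarrow> 0"
  proof (rule sufficient_decrease_tendsto_zero)
    show "f (x (Suc k)) + \<rho> (Suc k) * (norm (cc (Suc k)) - C)
        \<le> f (x k) + \<rho> k * (norm (cc k) - C) - \<eta>min * (1 - \<tau>) / 2 * (norm (s k))\<^sup>2" for k
    proof -
      have "\<rho> (Suc k) * (norm (cc (Suc k)) - C) \<le> \<rho> k * (norm (cc (Suc k)) - C)"
        using rho_mono cc_le by (intro mult_right_mono_neg) auto
      then show ?thesis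
        using merit_step[of k] by (simp add: right_diff_distrib)
    qed
    show "flow - \<rho>max * C \<le> f (x k) + \<rho> k * (norm (cc k) - C)" for k
    proof -
      have "\<rho> k * C \<le> \<rho>max * C"
        using rho_le A1(6) by (intro mult_right_mono) auto
      then show ?thesis
        using A1(5)[of "x k"] mult_nonneg_nonneg[OF less_imp_le[OF rho_pos[of k]] norm_ge_zero[of "cc k"]]
        by (simp add: right_diff_distrib)
    qed
  qed (use eta_min_pos inputs(2) in auto)
  then have lim: "(\<lambda>k. (1 + 1 / \<delta>\<^sup>2) * (norm (s k))\<^sup>2) \<longlonglongrightarrow> 0"
    by (rule tendsto_mult_right_zero)
  have bound: "(norm (p k))\<^sup>2 + (norm (cc k))\<^sup>2 \<le> (1 + 1 / \<delta>\<^sup>2) * (norm (s k))\<^sup>2" for k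
  proof -
    have "(\<delta> * norm (cc k))\<^sup>2 \<le> (norm (q k))\<^sup>2"
      using q_lower[of k] delta(1) by (intro power_mono) auto
    then have "(norm (cc k))\<^sup>2 \<le> (norm (q k))\<^sup>2 / \<delta>\<^sup>2"
      using delta(1) by (simp add: power_mult_distrib pos_le_divide_eq mult.commute)
    also have "\<dots> \<le> (norm (s k))\<^sup>2 / \<delta>\<^sup>2"
      by (simp add: s_norm divide_right_mono)
    finally have "(norm (cc k))\<^sup>2 \<le> (norm (s k))\<^sup>2 / \<delta>\<^sup>2" .
    moreover have "(norm (p k))\<^sup>2 \<le> (norm (s k))\<^sup>2"
      by (simp add: s_norm)
    ultimately have "(norm (p k))\<^sup>2 + (norm (cc k))\<^sup>2 \<le> (norm (s k))\<^sup>2 + (norm (s k))\<^sup>2 / \<delta>\<^sup>2"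
      by linarith
    then show ?thesis
      by (simp add: distrib_right)
  qed
  have "(\<lambda>k. (norm (p k))\<^sup>2 + (norm (cc k))\<^sup>2) \<longlonglongrightarrow> 0"
    by (rule tendsto_sandwich[OF _ _ tendsto_const lim]) (use bound in auto)
  then show ?thesis
    by (simp add: p_def g_def N_def cc_def)
qed

end
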